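(* Let $N\in\mathbb{N}$, $N\ge 1$, let $\lambda_1,\ldots,\lambda_N>0$ be real numbers, and let $X_1,\ldots,X_N$ be independent real random variables such that, for each $n$, $X_n$ is exponentially distributed with parameter $\lambda_n$. Then the maximum $M_N=\max_{1\le n\le N}X_n$ has the probability density function $$f_{M_N}(z)=\sum_{k=1}^{N}(-1)^{k+1}\sum_{1\le n_1<\cdots<n_k\le N}(\lambda_{n_1}+\cdots+\lambda_{n_k})\,e^{-(\lambda_{n_1}+\cdots+\lambda_{n_k})z},\qquad z\ge 0,$$ that is, $$f_{M_N}(z)=\sum_{n=1}^N\lambda_n e^{-\lambda_n z}-\sum_{1\le n<m\le N}(\lambda_n+\lambda_m)e^{-(\lambda_n+\lambda_m)z}+\ldots+(-1)^{N+1}\Big(\sum_{n=1}^N\lambda_n\Big)e^{-\left(\sum_{n=1}^N\lambda_n\right)z}.$$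
   Context: The exponential distribution with parameter (rate) $\lambda>0$ is the distribution on $[0,\infty)$ with density $x\mapsto\lambda e^{-\lambda x}$ with respect to Lebesgue measure on $[0,\infty)$ (density zero on $(-\infty,0)$). All densities are with respect to Lebesgue measure on $[0,\infty)$. *)

theory Defs
  imports "HOL-Probability.Probability"
begin

text \<open>The index tuples \<open>1 \<le> n\<^sub>1 < \<dots> < n\<^sub>k \<le> N\<close>, encoded as lists of length \<open>k\<close>.\<close>

definition increasing_indices :: "nat \<Rightarrow> nat \<Rightarrow> nat list set" where
  "increasing_indices N k =
    {ns. length ns = k \<and> sorted_wrt (<) ns \<and> set ns \<subseteq> {1..N}}"

text \<open>A density on \<open>[0, \<infinity>)\<close> is extended by zero to the whole real line, as in
  \<^const>\<open>exponential_density\<close>.\<close>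

definition max_exponential_density :: "nat \<Rightarrow> (nat \<Rightarrow> real) \<Rightarrow> real \<Rightarrow> real" where
  "max_exponential_density N l z =
    (if z < 0 then 0
     else \<Sum>k = 1..N. (- 1) ^ (k + 1) *
       (\<Sum>ns \<in> increasing_indices N k.
          (\<Sum>n\<leftarrow>ns. l n) * exp (- (\<Sum>n\<leftarrow>ns. l n) * z)))"

end

theory Submission
  imports Defs
begin

text \<open>
  The maximum is at most \<open>z\<close> exactly when every variable is, so by independence its distribution
  function on \<open>[0, \<infinity>)\<close> is \<open>F z = (\<Prod>n. 1 - exp (- l n * z))\<close>. Everything is a consequence of
  computing the derivative of \<open>F\<close> in two ways.

  Multiplying \<open>F\<close> out first gives the alternating sum \<open>\<Sum>A. (- 1) ^ card A * exp (- sum l A * z)\<close>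
  over all sets \<open>A\<close> of indices, whose termwise derivative is the claimed density once sets of
  indices are identified with their increasing enumerations
  (\<open>max_exponential_density_eq_sum_subsets\<close>). The product rule instead gives
  \<open>\<Sum>n. l n * exp (- l n * z) * (\<Prod>m \<noteq> n. 1 - exp (- l m * z))\<close>, in which no term is negative for
  \<open>z \<ge> 0\<close>; the signs of the alternating sum are not visible from its own terms. The fundamental
  theorem of calculus and \<open>F 0 = 0\<close> then show that the density integrates to \<open>F\<close>, and a
  distribution on the line is determined by its distribution function.
\<close>

section \<open>Increasing index tuples and sets of indices\<close>

lemma bij_betw_set_increasing_indices:
  "bij_betw set (increasing_indices N k) {A. A \<subseteq> {1..N} \<and> card A = k}"
proof (rule bij_betw_byWitness[where f' = sorted_list_of_set])
  show "\<forall>ns\<in>increasing_indices N k. sorted_list_of_set (set ns) = ns"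
    by (auto simp: increasing_indices_def strict_sorted_iff sorted_list_of_set.idem_if_sorted_distinct)
  show "\<forall>A\<in>{A. A \<subseteq> {1..N} \<and> card A = k}. set (sorted_list_of_set A) = A"
    by (auto simp: finite_subset[of _ "{1..N}"])
  show "set ` increasing_indices N k \<subseteq> {A. A \<subseteq> {1..N} \<and> card A = k}"
    by (auto simp: increasing_indices_def strict_sorted_iff distinct_card)
  show "sorted_list_of_set ` {A. A \<subseteq> {1..N} \<and> card A = k} \<subseteq> increasing_indices N k"
  proof (rule image_subsetI)
    fix A assume A: "A \<in> {A. A \<subseteq> {1..N} \<and> card A = k}"
    then have "finite A"
      by (auto intro: finite_subset)
    then show "sorted_list_of_set A \<in> increasing_indices N k"
      using A unfolding increasing_indices_def by simp
  qed
qed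

lemma sum_increasing_indices:
  fixes l :: "nat \<Rightarrow> real" and g :: "real \<Rightarrow> real"
  shows "(\<Sum>ns\<in>increasing_indices N k. g (\<Sum>n\<leftarrow>ns. l n)) =
    (\<Sum>A | A \<subseteq> {1..N} \<and> card A = k. g (sum l A))"
proof -
  have "(\<Sum>ns\<in>increasing_indices N k. g (\<Sum>n\<leftarrow>ns. l n)) =
      (\<Sum>ns\<in>increasing_indices N k. g (sum l (set ns)))"
    by (intro sum.cong)
      (auto simp: increasing_indices_def strict_sorted_iff sum_list_distinct_conv_sum_set)
  also have "\<dots> = (\<Sum>A | A \<subseteq> {1..N} \<and> card A = k. g (sum l A))"
    by (rule sum.reindex_bij_betw[OF bij_betw_set_increasing_indices])
  finally show ?thesis .
qed

text \<open>The empty set may be included because its term has the factor \<open>sum l {} = 0\<close>.\<close>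

lemma max_exponential_density_eq_sum_subsets:
  assumes "0 \<le> z"
  shows "max_exponential_density N l z =
    (\<Sum>A\<in>Pow {1..N}. (- 1) ^ (card A + 1) * (sum l A * exp (- sum l A * z)))"
proof -
  define h where "h A = (- 1) ^ (card A + 1) * (sum l A * exp (- sum l A * z))" for A
  have card_mem: "card ` (Pow {1..N} - {{}}) \<subseteq> {1..N}"
  proof (rule image_subsetI)
    fix A assume "A \<in> Pow {1..N} - {{}}"
    then have A: "A \<subseteq> {1..N}" "A \<noteq> {}"
      by auto
    then show "card A \<in> {1..N}"
      using card_mono[OF _ A(1)] finite_subset[OF A(1)] by (simp add: Suc_le_eq card_gt_0_iff)
  qed
  have "max_exponential_density N l z =
      (\<Sum>k = 1..N. \<Sum>A | A \<subseteq> {1..N} \<and> card A = k. h A)"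
    using assms
    by (simp add: max_exponential_density_def h_def sum_distrib_left
        sum_increasing_indices[where g = "\<lambda>s. s * exp (- s * z)", simplified])
  also have "\<dots> = (\<Sum>k = 1..N. \<Sum>A | A \<in> Pow {1..N} - {{}} \<and> card A = k. h A)"
    by (intro sum.cong) auto
  also have "\<dots> = sum h (Pow {1..N} - {{}})"
    by (rule sum.group) (use card_mem in auto)
  also have "\<dots> = sum h (Pow {1..N})"
    by (rule sum.mono_neutral_left) (auto simp: h_def)
  finally show ?thesis
    by (simp add: h_def)
qed

section \<open>The two derivatives of the distribution function\<close>

lemma has_field_derivative_prod_one_minus_exp_expanded:
  fixes l :: "'i \<Rightarrow> real"
  assumes "finite I"
  shows "((\<lambda>z. \<Prod>i\<in>I. 1 - exp (- l i * z)) has_field_derivative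
    (\<Sum>A\<in>Pow I. (- 1) ^ (card A + 1) * (sum l A * exp (- sum l A * z)))) (at z)"
proof -
  have "(\<Prod>i\<in>A. exp (- l i * z)) = exp (- sum l A * z)" if "A \<subseteq> I" for A z
    using finite_subset[OF that assms] by (simp add: exp_sum sum_distrib_right sum_negf[symmetric])
  then have expand: "(\<lambda>z. \<Prod>i\<in>I. 1 - exp (- l i * z)) =
      (\<lambda>z. \<Sum>A\<in>Pow I. (- 1) ^ card A * exp (- sum l A * z))"
    using assms by (auto simp: prod_diff_conv_sum intro!: sum.cong)
  show ?thesis
    unfolding expand by (auto intro!: derivative_eq_intros sum.cong)
qed

lemma has_field_derivative_prod_one_minus_exp:
  fixes l :: "'i \<Rightarrow> real"
  shows "((\<lambda>z. \<Prod>i\<in>I. 1 - exp (- l i * z)) has_field_derivative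
    (\<Sum>i\<in>I. l i * exp (- l i * z) * (\<Prod>j\<in>I - {i}. 1 - exp (- l j * z)))) (at z)"
  by (rule has_field_derivative_prod) (auto intro!: derivative_eq_intros)

lemma DERIV_prod_one_minus_exp_max_density:
  assumes "0 \<le> z"
  shows "((\<lambda>z. \<Prod>n\<in>{1..N}. 1 - exp (- l n * z)) has_field_derivative
    max_exponential_density N l z) (at z)"
  unfolding max_exponential_density_eq_sum_subsets[OF assms]
  by (rule has_field_derivative_prod_one_minus_exp_expanded) simp

text \<open>By uniqueness of the derivative, the density equals the sum given by the product rule.\<close>

lemma max_exponential_density_nonneg:
  assumes "\<And>n. n \<in> {1..N} \<Longrightarrow> 0 < l n"
  shows "0 \<le> max_exponential_density N l z"
proof (cases "z < 0")
  case True
  then show ?thesis by (simp add: max_exponential_density_def)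
next
  case False
  then have z: "0 \<le> z" by simp
  have "max_exponential_density N l z =
      (\<Sum>n\<in>{1..N}. l n * exp (- l n * z) * (\<Prod>m\<in>{1..N} - {n}. 1 - exp (- l m * z)))"
    by (rule DERIV_unique[OF DERIV_prod_one_minus_exp_max_density[OF z]
          has_field_derivative_prod_one_minus_exp])
  also have "\<dots> \<ge> 0"
    using assms z
    by (intro sum_nonneg mult_nonneg_nonneg prod_nonneg) (auto simp: less_imp_le)
  finally show ?thesis .
qed

lemma borel_measurable_max_exponential_density:
  "max_exponential_density N l \<in> borel_measurable borel"
  unfolding max_exponential_density_def[abs_def] by measurable

lemma nn_integral_max_exponential_density:
  assumes l: "\<And>n. n \<in> {1..N} \<Longrightarrow> 0 < l n" and "N \<ge> 1" and "0 \<le> a"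
  shows "(\<integral>\<^sup>+z. ennreal (max_exponential_density N l z * indicator {..a} z) \<partial>lborel) =
    ennreal (\<Prod>n\<in>{1..N}. 1 - exp (- l n * a))"
proof -
  have "(\<integral>\<^sup>+z. ennreal (max_exponential_density N l z * indicator {..a} z) \<partial>lborel) =
      (\<integral>\<^sup>+z. ennreal (max_exponential_density N l z) * indicator {0..a} z \<partial>lborel)"
    by (intro nn_integral_cong) (auto simp: max_exponential_density_def split: split_indicator)
  also have "\<dots> = ennreal ((\<Prod>n\<in>{1..N}. 1 - exp (- l n * a)) - (\<Prod>n\<in>{1..N}. 1 - exp (- l n * 0)))"
  proof (rule nn_integral_FTC_Icc)
    fix x :: real assume "x \<in> {0..a}"
    then show "((\<lambda>z. \<Prod>n\<in>{1..N}. 1 - exp (- l n * z)) has_field_derivative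
        max_exponential_density N l x) (at x)"
      by (intro DERIV_prod_one_minus_exp_max_density) simp
  qed (use assms in \<open>auto intro: max_exponential_density_nonneg
        simp: borel_measurable_max_exponential_density\<close>)
  also have "(\<Prod>n\<in>{1..N}. 1 - exp (- l n * 0)) = 0"
    using \<open>N \<ge> 1\<close> by auto
  finally show ?thesis by simp
qed

section \<open>The distribution of the maximum\<close>

text \<open>For negative \<open>a\<close>, the event is contained in the null event \<open>X i \<le> 0\<close>, for any index \<open>i\<close>.\<close>

lemma (in prob_space) prob_Max_exponential_le:
  fixes X :: "'i \<Rightarrow> 'a \<Rightarrow> real"
  assumes I: "finite I" "I \<noteq> {}"
    and l: "\<And>i. i \<in> I \<Longrightarrow> 0 < l i"
    and indep: "indep_vars (\<lambda>_. borel) X I"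
    and X: "\<And>i. i \<in> I \<Longrightarrow> distributed M lborel (X i) (exponential_density (l i))"
  shows "\<P>(\<omega> in M. (MAX i\<in>I. X i \<omega>) \<le> a) =
    (if a < 0 then 0 else \<Prod>i\<in>I. 1 - exp (- l i * a))"
proof (cases "a < 0")
  case True
  from I obtain i where i: "i \<in> I" by blast
  have [measurable]: "X i \<in> borel_measurable M"
    using distributed_measurable[OF X[OF i]] by simp
  have "\<P>(\<omega> in M. (MAX i\<in>I. X i \<omega>) \<le> a) \<le> \<P>(\<omega> in M. X i \<omega> \<le> 0)"
  proof (rule finite_measure_mono)
    have "X i \<omega> \<le> 0" if "(MAX i\<in>I. X i \<omega>) \<le> a" for \<omega>
    proof -
      have "X i \<omega> \<le> (MAX i\<in>I. X i \<omega>)"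
        using I i by (intro Max_ge) auto
      then show ?thesis
        using that True by linarith
    qed
    then show "{\<omega> \<in> space M. (MAX i\<in>I. X i \<omega>) \<le> a} \<subseteq> {\<omega> \<in> space M. X i \<omega> \<le> 0}"
      by blast
  qed measurable
  also have "\<dots> = 0"
    using exponential_distributedD_le[OF X[OF i] _ l[OF i], of 0] by simp
  finally show ?thesis
    using True by (simp add: measure_le_0_iff)
next
  case False
  have "{\<omega> \<in> space M. (MAX i\<in>I. X i \<omega>) \<le> a} = (\<Inter>i\<in>I. X i -` {..a} \<inter> space M)"
    using I by auto
  then have "\<P>(\<omega> in M. (MAX i\<in>I. X i \<omega>) \<le> a) = (\<Prod>i\<in>I. prob (X i -` {..a} \<inter> space M))"
    using indep_varsD_finite[OF indep I(2,1), of "\<lambda>_. {..a}"] by simp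
  also have "\<dots> = (\<Prod>i\<in>I. 1 - exp (- l i * a))"
  proof (rule prod.cong)
    fix i assume i: "i \<in> I"
    have "X i -` {..a} \<inter> space M = {\<omega> \<in> space M. X i \<omega> \<le> a}"
      by auto
    then show "prob (X i -` {..a} \<inter> space M) = 1 - exp (- l i * a)"
      using exponential_distributedD_le[OF X[OF i] _ l[OF i], of a] False
      by (simp add: mult.commute)
  qed simp
  finally show ?thesis
    using False by simp
qed

theorem proposition3p2:
  fixes M :: "'a measure" and N :: nat and l :: "nat \<Rightarrow> real" and X :: "nat \<Rightarrow> 'a \<Rightarrow> real"
  assumes "prob_space M"
    and "N \<ge> 1"
    and "\<And>n. n \<in> {1..N} \<Longrightarrow> l n > 0"
    and "prob_space.indep_vars M (\<lambda>_. borel) X {1..N}"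
    and "\<And>n. n \<in> {1..N} \<Longrightarrow>
      distributed M lborel (X n) (\<lambda>x. ennreal (exponential_density (l n) x))"
  shows "(\<forall>z. 0 \<le> max_exponential_density N l z) \<and>
    distributed M lborel (\<lambda>\<omega>. MAX n\<in>{1..N}. X n \<omega>)
      (\<lambda>z. ennreal (max_exponential_density N l z))"
proof -
  interpret prob_space M by fact
  define F where "F a = (if a < 0 then 0 else \<Prod>n\<in>{1..N}. 1 - exp (- l n * a))" for a
  have nonneg: "0 \<le> max_exponential_density N l z" for z
    using assms(3) by (rule max_exponential_density_nonneg)
  have "distributed M lborel (\<lambda>\<omega>. MAX n\<in>{1..N}. X n \<omega>) (max_exponential_density N l)"
  proof (rule distributedI_borel_atMost)
    have "X n \<in> borel_measurable M" if "n \<in> {1..N}" for n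
      using distributed_measurable[OF assms(5)[OF that]] by simp
    then show "(\<lambda>\<omega>. MAX n\<in>{1..N}. X n \<omega>) \<in> borel_measurable M"
      by (intro borel_measurable_Max) auto
    show "max_exponential_density N l \<in> borel_measurable borel"
      by (rule borel_measurable_max_exponential_density)
    show "AE z in lborel. 0 \<le> max_exponential_density N l z"
      using nonneg by simp
  next
    fix a
    show "emeasure M {\<omega> \<in> space M. (MAX n\<in>{1..N}. X n \<omega>) \<le> a} = ennreal (F a)"
      using prob_Max_exponential_le[of "{1..N}" l X a] assms
      by (simp add: emeasure_eq_measure F_def)
    show "(\<integral>\<^sup>+z. ennreal (max_exponential_density N l z * indicator {..a} z) \<partial>lborel) = ennreal (F a)"
    proof (cases "a < 0")
      case True
      then have "(\<lambda>z. ennreal (max_exponential_density N l z * indicator {..a} z)) = (\<lambda>_. 0)"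
        by (auto simp: max_exponential_density_def split: split_indicator)
      then show ?thesis
        using True by (simp only: F_def) simp
    next
      case False
      then show ?thesis
        using nn_integral_max_exponential_density[of N l a] assms(2,3) by (simp add: F_def)
    qed
  qed
  with nonneg show ?thesis
    by blast
qed

end
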